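(* Let $\mathbb D=\{z\in\mathbb C:|z|<1\}$. For each measurable function $\varphi:\partial\mathbb D\to\mathbb R$ there exist harmonic functions $u:\mathbb D\to\mathbb R$ such that, at a.e. point $\zeta\in\partial\mathbb D$, the following exist, where $n=n(\zeta)$ denotes the unit interior normal to $\partial\mathbb D$ at $\zeta$: 1) the finite radial limit $$u(\zeta):=\lim_{r\to1}u(r\zeta);$$ 2) the normal derivative $$\frac{\partial u}{\partial n}(\zeta):=\lim_{t\to0}\frac{u(\zeta+t\cdot n)-u(\zeta)}{t}=\varphi(\zeta);$$ 3) the nontangential limit $$\lim_{z\to\zeta}\frac{\partial u}{\partial n}(z)=\frac{\partial u}{\partial n}(\zeta).$$
   Context: A harmonic function is a twice continuously differentiable solution of the Laplace equation $u_{xx}+u_{yy}=0$. Measurability and "a.e." on $\partial\mathbb D$ are with respect to arc length. No integrability or boundedness of $\varphi$ is assumed. The unit interior normal at $\zeta\in\partial\mathbb D$ is $n(\zeta)=-\zeta$. In 1), $r\to1$ with $r<1$; in 2), $t\to0$ with $t>0$ (so that $\zeta+tn\in\mathbb D$), and $u(\zeta)$ is the value from 1). In 3), for $z\in\mathbb D$, $\frac{\partial u}{\partial n}(z)$ denotes the derivative of $u$ at $z$ in the fixed direction $n=n(\zeta)$, i.e. the scalar product in $\mathbb R^2$ of $n(\zeta)$ and $\nabla u(z)$. A path in $\mathbb D$ ending at $\zeta$ is nontangential if, near $\zeta$, it lies in a set $\{z\in\mathbb D:|z-\zeta|\le M\,\mathrm{dist}(z,\partial\mathbb D)\}$ for some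 finite $M$ (a Stolz angle at $\zeta$). The nontangential limit is the limit along all nontangential paths to $\zeta$. *)

theory Defs
  imports "HOL-Analysis.Analysis"
begin

definition dir_deriv :: "complex \<Rightarrow> (complex \<Rightarrow> real) \<Rightarrow> complex \<Rightarrow> real"
  where "dir_deriv v f z = frechet_derivative f (at z) v"

definition C1_on :: "complex set \<Rightarrow> (complex \<Rightarrow> real) \<Rightarrow> bool"
  where "C1_on S f \<longleftrightarrow>
    (\<forall>z\<in>S. f differentiable (at z)) \<and> (\<forall>v. continuous_on S (dir_deriv v f))"

definition C2_on :: "complex set \<Rightarrow> (complex \<Rightarrow> real) \<Rightarrow> bool"
  where "C2_on S f \<longleftrightarrow> C1_on S f \<and> (\<forall>v. C1_on S (dir_deriv v f))"

text \<open>Meant for open \<open>S\<close>, where values of \<open>u\<close> outside \<open>S\<close> do not matter.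
  The directions \<open>1\<close> and \<open>\<i>\<close> are those of the coordinates \<open>x\<close> and \<open>y\<close>.\<close>

definition harmonic_function_on :: "complex set \<Rightarrow> (complex \<Rightarrow> real) \<Rightarrow> bool"
  where "harmonic_function_on S u \<longleftrightarrow>
    C2_on S u \<and>
    (\<forall>z\<in>S. dir_deriv 1 (dir_deriv 1 u) z + dir_deriv \<i> (dir_deriv \<i> u) z = 0)"

text \<open>Arc length on the unit circle, as a complete measure whose space is the circle: measurable
  functions are the Lebesgue measurable ones, and their values off the circle are irrelevant.\<close>

definition arc_length_measure :: "complex measure"
  where "arc_length_measure = completion
    (distr (restrict_space lborel {0..<2 * pi}) (restrict_space borel (sphere 0 1)) cis)"

definition interior_normal :: "complex \<Rightarrow> complex"
  where "interior_normal \<zeta> = - \<zeta>"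

definition Stolz_angle :: "complex \<Rightarrow> real \<Rightarrow> complex set"
  where "Stolz_angle \<zeta> M = {z \<in> ball 0 1. dist z \<zeta> \<le> M * infdist z (sphere 0 1)}"

definition nontangential_path :: "complex \<Rightarrow> (real \<Rightarrow> complex) \<Rightarrow> bool"
  where "nontangential_path \<zeta> \<gamma> \<longleftrightarrow>
    path \<gamma> \<and> pathfinish \<gamma> = \<zeta> \<and> \<gamma> ` {0..<1} \<subseteq> ball 0 1 \<and>
    (\<exists>M. \<forall>\<^sub>F t in at_left 1. \<gamma> t \<in> Stolz_angle \<zeta> M)"

definition has_nontangential_limit :: "(complex \<Rightarrow> real) \<Rightarrow> real \<Rightarrow> complex \<Rightarrow> bool"
  where "has_nontangential_limit g l \<zeta> \<longleftrightarrow>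
    (\<forall>\<gamma>. nontangential_path \<zeta> \<gamma> \<longrightarrow> ((\<lambda>t. g (\<gamma> t)) \<longlongrightarrow> l) (at_left 1))"

lemma space_arc_length_measure [simp]: "space arc_length_measure = sphere 0 1"
  by (simp add: arc_length_measure_def space_restrict_space)

lemma measurable_cis_circle:
  "cis \<in> restrict_space lborel {0..<2 * pi} \<rightarrow>\<^sub>M restrict_space borel (sphere 0 1)"
proof (rule measurable_restrict_space2)
  have "cis \<in> borel_measurable borel"
    by (intro borel_measurable_continuous_onI continuous_intros)
  then have "cis \<in> borel_measurable lborel"
    by simp
  then show "cis \<in> borel_measurable (restrict_space lborel {0..<2 * pi})"
    by (rule measurable_restrict_space1)
qed auto

lemma emeasure_arc_length_measure_circle:
  "emeasure arc_length_measure (sphere 0 1) = ennreal (2 * pi)"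
proof -
  let ?L = "restrict_space lborel {0..<2 * pi}"
  let ?C = "restrict_space borel (sphere 0 1) :: complex measure"
  have S: "sphere 0 1 \<in> sets ?C"
    by (metis sets.top space_restrict_space space_borel Int_UNIV_right)
  have "emeasure arc_length_measure (sphere 0 1) = emeasure (distr ?L ?C cis) (sphere 0 1)"
    unfolding arc_length_measure_def using S by simp
  also have "\<dots> = emeasure ?L (cis -` sphere 0 1 \<inter> space ?L)"
    by (rule emeasure_distr[OF measurable_cis_circle S])
  also have "cis -` sphere 0 1 \<inter> space ?L = {0..<2 * pi}"
    by (auto simp: space_restrict_space)
  also have "emeasure ?L {0..<2 * pi} = ennreal (2 * pi)"
    by (subst emeasure_restrict_space) auto
  finally show ?thesis .
qed

end

theory Submission
  imports Defs "HOL-Complex_Analysis.Complex_Analysis" "HOL-Real_Asymp.Real_Asymp"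
begin

text \<open>
It suffices to find a holomorphic function \<open>g\<close> in the disc that at almost every \<open>\<zeta>\<close> of the circle
has a nontangential limit, called \<open>g \<zeta>\<close>, with \<open>Re (\<zeta> * g \<zeta>) = \<phi> \<zeta>\<close>. Indeed, let \<open>F\<close> be a primitive of
\<open>g\<close> and \<open>u = - Re F\<close>. The derivative of \<open>u\<close> in the direction \<open>- \<zeta>\<close> is \<open>Re (\<zeta> * g z)\<close>, so its
nontangential limit at \<open>\<zeta>\<close> is \<open>\<phi> \<zeta>\<close>; and since \<open>g\<close> is continuous on the closed radius, integration
along that radius gives the radial limit of \<open>u\<close> and the normal derivative \<open>\<phi> \<zeta>\<close> at the endpoint
(\<open>harmonic_minus_Re_primitive\<close>, \<open>radial_limit_and_normal_derivative\<close>,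
\<open>nontangential_limit_from_closed_Stolz\<close>).

The function \<open>g\<close> is an explicit series, which takes the place of Poisson integrals and of primitives
of \<open>\<phi>\<close> along the circle. The map \<open>w \<mapsto> - 2 w / (1 - w)\<close> takes the unit circle to the line \<open>Re = 1\<close>.
Hence, if \<open>Q\<close> is a Laurent polynomial that is real on the circle, the function
\<open>- 2 z ^ N / (1 - z ^ N) * Q z\<close> has real part \<open>Q\<close> on the circle, apart from the \<open>N\<close>-th roots of
unity, and yet tends to zero locally uniformly in the disc as \<open>N\<close> grows. In terms of measures,
\<open>Q\<close> times arc length has been almost cancelled by point masses at the roots of unity, which do not
affect the boundary values elsewhere. In a Stolz angle at \<open>\<zeta>\<close> the singular factor is bounded by a
multiple of \<open>1 / \<bar>1 - \<zeta> ^ N\<bar>\<close>, uniformly in \<open>N\<close> (\<open>one_minus_power_lower_bound_Stolz\<close>). With \<open>N\<close> large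
this bounds the whole function there by a multiple of \<open>(\<bar>Q \<zeta>\<bar> + c) / \<bar>1 - \<zeta> ^ N\<bar>\<close>, with \<open>c\<close> as small as
desired (\<open>exists_small_piece\<close>).

Real polynomials in the two coordinates are Laurent polynomials on the circle. A measurable \<open>\<phi>\<close> is
almost everywhere a limit of such polynomials at the speed \<open>4 ^ (-k)\<close>
(\<open>fast_polynomial_approximation_on_circle\<close>), so it is the sum of a telescoping series whose terms
\<open>Q k\<close> eventually satisfy \<open>\<bar>Q k \<zeta>\<bar> \<le> 2 * 4 ^ (-k)\<close>. The set of \<open>\<zeta>\<close> with \<open>\<bar>1 - \<zeta> ^ N\<bar> < \<epsilon>\<close> has measure
at most \<open>8 \<epsilon>\<close> for every \<open>N\<close>, so almost every \<open>\<zeta>\<close> eventually satisfies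
\<open>\<bar>1 - \<zeta> ^ N k\<bar> \<ge> 2 ^ (-k-1)\<close> (\<open>AE_eventually_far_from_roots_of_unity\<close>). At such \<open>\<zeta>\<close> the summands are
of order \<open>2 ^ (-k)\<close> in each Stolz angle, and the sum is continuous up to the vertex
(\<open>holomorphic_with_boundary_series\<close>).
\<close>

section \<open>Functions on the disc with prescribed real part on the circle\<close>

text \<open>On the circle \<open>cnj \<zeta> = 1 / \<zeta>\<close>, so both coordinates, and hence every real polynomial in them, are
Laurent polynomials in \<open>\<zeta>\<close>; the factor \<open>\<zeta> ^ K\<close> clears the pole at \<open>0\<close>.\<close>

lemma real_polynomial_on_circle:
  assumes "real_polynomial_function (q :: complex \<Rightarrow> real)"
  obtains K P where "P holomorphic_on UNIV"
    "\<And>\<zeta>. cmod \<zeta> = 1 \<Longrightarrow> P \<zeta> = \<zeta> ^ K * of_real (q \<zeta>)"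
proof -
  have "\<exists>K P. P holomorphic_on UNIV \<and> (\<forall>\<zeta>. cmod \<zeta> = 1 \<longrightarrow> P \<zeta> = \<zeta> ^ K * of_real (q \<zeta>))"
    using assms
  proof induction
    case (linear f)
    define a b where "a = complex_of_real (f 1)" and "b = complex_of_real (f \<i>)"
    have f: "f z = Re z * f 1 + Im z * f \<i>" for z
    proof -
      have "f (Re z *\<^sub>R 1 + Im z *\<^sub>R \<i>) = Re z * f 1 + Im z * f \<i>"
        by (simp only: bounded_linear.linear[OF linear] linear_add linear_scale real_scaleR_def)
      moreover have "Re z *\<^sub>R 1 + Im z *\<^sub>R \<i> = z"
        by (simp add: complex_eq_iff)
      ultimately show ?thesis by metis
    qed
    define P where "P = (\<lambda>z. (z\<^sup>2 + 1) / 2 * a + (z\<^sup>2 - 1) / (2 * \<i>) * b)"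
    have "P \<zeta> = \<zeta> ^ 1 * of_real (f \<zeta>)" if "cmod \<zeta> = 1" for \<zeta>
    proof -
      have "\<zeta> * cnj \<zeta> = 1"
        using that by (simp add: complex_norm_square[symmetric])
      moreover have "2 * complex_of_real (Re \<zeta>) = \<zeta> + cnj \<zeta>" "2 * \<i> * complex_of_real (Im \<zeta>) = \<zeta> - cnj \<zeta>"
        by (simp_all add: complex_eq_iff)
      ultimately have "2 * (\<zeta> * of_real (Re \<zeta>)) = \<zeta>\<^sup>2 + 1" "2 * \<i> * (\<zeta> * of_real (Im \<zeta>)) = \<zeta>\<^sup>2 - 1"
        by algebra+
      then have "(\<zeta>\<^sup>2 + 1) / 2 = \<zeta> * of_real (Re \<zeta>)" "(\<zeta>\<^sup>2 - 1) / (2 * \<i>) = \<zeta> * of_real (Im \<zeta>)"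
        by (metis nonzero_mult_div_cancel_left zero_neq_numeral, metis nonzero_mult_div_cancel_left
            zero_neq_numeral complex_i_not_zero mult_eq_0_iff)
      then have "P \<zeta> = \<zeta> * of_real (Re \<zeta>) * a + \<zeta> * of_real (Im \<zeta>) * b"
        by (simp only: P_def)
      then show ?thesis
        by (simp add: f[of \<zeta>] a_def b_def distrib_left mult.assoc)
    qed
    moreover have "P holomorphic_on UNIV"
      unfolding P_def by (intro holomorphic_intros) auto
    ultimately show ?case by blast
  next
    case (const c)
    have "(\<lambda>z. complex_of_real c) holomorphic_on UNIV" by simp
    then show ?case by (intro exI[of _ 0] exI[of _ "\<lambda>z. complex_of_real c"]) auto
  next
    case (add f g)
    then obtain K P L Q where
      P: "P holomorphic_on UNIV" "\<And>\<zeta>. cmod \<zeta> = 1 \<Longrightarrow> P \<zeta> = \<zeta> ^ K * of_real (f \<zeta>)" and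
      Q: "Q holomorphic_on UNIV" "\<And>\<zeta>. cmod \<zeta> = 1 \<Longrightarrow> Q \<zeta> = \<zeta> ^ L * of_real (g \<zeta>)"
      by blast
    show ?case
      by (rule exI[of _ "K + L"], rule exI[of _ "\<lambda>z. z ^ L * P z + z ^ K * Q z"])
        (auto simp: P Q algebra_simps power_add intro!: holomorphic_intros)
  next
    case (mult f g)
    then obtain K P L Q where
      P: "P holomorphic_on UNIV" "\<And>\<zeta>. cmod \<zeta> = 1 \<Longrightarrow> P \<zeta> = \<zeta> ^ K * of_real (f \<zeta>)" and
      Q: "Q holomorphic_on UNIV" "\<And>\<zeta>. cmod \<zeta> = 1 \<Longrightarrow> Q \<zeta> = \<zeta> ^ L * of_real (g \<zeta>)"
      by blast
    show ?case
      by (rule exI[of _ "K + L"], rule exI[of _ "\<lambda>z. P z * Q z"])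
        (auto simp: P Q algebra_simps power_add intro!: holomorphic_intros)
  qed
  then show ?thesis using that by blast
qed

text \<open>The Moebius map \<open>w \<mapsto> - 2 w / (1 - w)\<close> sends the circle to the line \<open>Re = 1\<close>, and \<open>0\<close> to \<open>0\<close>.\<close>

lemma Re_neg_two_times_over_one_minus:
  assumes "cmod w = 1" "w \<noteq> 1"
  shows "Re (- 2 * w / (1 - w)) = 1"
proof -
  have w: "Re w * Re w + Im w * Im w = 1"
    using assms(1) by (metis cmod_power2 one_power2 power2_eq_square)
  have "Re w \<noteq> 1"
    using w assms(2) by (auto simp: complex_eq_iff)
  moreover have "(1 - Re w)\<^sup>2 + (Im w)\<^sup>2 = 2 * (1 - Re w)"
    using w by (simp add: power2_eq_square algebra_simps)
  ultimately show ?thesis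
    using w by (simp add: Re_divide) (simp add: field_simps)
qed

text \<open>With \<open>N = K + m + 1\<close>, this is \<open>- 2 z ^ N / (1 - z ^ N)\<close> times the Laurent polynomial
\<open>P z / z ^ K\<close>, divided by \<open>z\<close> once more. The exponent is parametrised by \<open>m\<close> so that the quotient has
no pole at \<open>0\<close>. The division by \<open>z\<close> is there because the function serves as a summand of the complex
derivative of a primitive, whose radial derivative on the circle is \<open>\<zeta>\<close> times its value.\<close>

definition boundary_piece :: "nat \<Rightarrow> (complex \<Rightarrow> complex) \<Rightarrow> nat \<Rightarrow> complex \<Rightarrow> complex"
  where "boundary_piece K P m z = - 2 * z ^ m * P z / (1 - z ^ Suc (K + m))"

lemma Re_boundary_piece:
  assumes "cmod \<zeta> = 1" "\<zeta> ^ Suc (K + m) \<noteq> 1" "P \<zeta> = \<zeta> ^ K * of_real q"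
  shows "Re (\<zeta> * boundary_piece K P m \<zeta>) = q"
proof -
  define w where "w = \<zeta> ^ Suc (K + m)"
  have eq: "\<zeta> * boundary_piece K P m \<zeta> = of_real q * (- 2 * w / (1 - w))"
    unfolding boundary_piece_def assms(3) w_def by (simp add: power_add algebra_simps)
  have "cmod w = 1"
    unfolding w_def by (simp only: norm_power assms(1) power_one)
  moreover have "w \<noteq> 1" using assms(2) by (simp add: w_def)
  ultimately have "Re (- 2 * w / (1 - w)) = 1"
    by (rule Re_neg_two_times_over_one_minus)
  then show ?thesis
    unfolding eq times_complex.sel by (simp del: Re_divide_of_real)
qed

lemma boundary_piece_holomorphic:
  assumes "P holomorphic_on UNIV"
  shows "boundary_piece K P m holomorphic_on ball 0 1"
proof -
  have "1 - z ^ Suc (K + m) \<noteq> 0" if "z \<in> ball 0 1" for z :: complex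
  proof
    assume "1 - z ^ Suc (K + m) = 0"
    then have "cmod z ^ Suc (K + m) = 1" by (metis norm_one norm_power right_minus_eq)
    moreover have "cmod z ^ Suc (K + m) \<le> cmod z ^ 1"
      using that by (intro power_decreasing) auto
    ultimately show False using that by simp
  qed
  moreover have "P holomorphic_on ball 0 1"
    using assms holomorphic_on_subset by blast
  ultimately show ?thesis
    unfolding boundary_piece_def by (intro holomorphic_intros) auto
qed

text \<open>The factor \<open>z ^ m\<close> makes the function negligible inside the disc, although the boundary values given by
\<open>Re_boundary_piece\<close> are the same for all \<open>m\<close>. This is possible because the poles, the roots of unity of
order \<open>Suc (K + m)\<close>, become dense.\<close>

lemma boundary_piece_small:
  assumes "continuous_on UNIV P" "0 \<le> r" "r < 1" "0 < \<epsilon>"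
  obtains m0 where "\<And>m z. m \<ge> m0 \<Longrightarrow> cmod z \<le> r \<Longrightarrow> cmod (boundary_piece K P m z) \<le> \<epsilon>"
proof -
  have "bounded (P ` cball 0 1)"
    using assms(1) compact_cball compact_continuous_image compact_imp_bounded continuous_on_subset
    by (metis subset_UNIV)
  then obtain B where B: "B > 0" "\<And>z. cmod z \<le> 1 \<Longrightarrow> cmod (P z) \<le> B"
    unfolding bounded_pos by auto
  have "(\<lambda>m. 2 * r ^ m * B / (1 - r)) \<longlonglongrightarrow> 2 * 0 * B / (1 - r)"
    using assms by (intro tendsto_intros LIMSEQ_realpow_zero) auto
  then have "\<forall>\<^sub>F m in sequentially. 2 * r ^ m * B / (1 - r) < \<epsilon>"
    using assms(4) by (intro order_tendstoD(2)) auto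
  then obtain m0 where m0: "\<And>m. m \<ge> m0 \<Longrightarrow> 2 * r ^ m * B / (1 - r) < \<epsilon>"
    unfolding eventually_sequentially by blast
  have "cmod (boundary_piece K P m z) \<le> \<epsilon>" if "m \<ge> m0" "cmod z \<le> r" for m z
  proof -
    have "cmod (z ^ Suc (K + m)) \<le> r"
    proof -
      have "cmod z ^ Suc (K + m) \<le> cmod z ^ 1"
        using that assms by (intro power_decreasing) auto
      then show ?thesis using that by (simp add: norm_power norm_mult)
    qed
    moreover have "1 - cmod (z ^ Suc (K + m)) \<le> cmod (1 - z ^ Suc (K + m))"
      using norm_triangle_ineq2[of 1 "z ^ Suc (K + m)"] by simp
    ultimately have "1 - r \<le> cmod (1 - z ^ Suc (K + m))" by linarith
    moreover have "cmod (- 2 * z ^ m * P z) \<le> 2 * r ^ m * B"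
      using that B(2)[of z] assms by (simp add: norm_mult norm_power mult_mono power_mono)
    ultimately have "cmod (boundary_piece K P m z) \<le> 2 * r ^ m * B / (1 - r)"
      unfolding boundary_piece_def norm_divide using assms B by (intro frac_le) auto
    then show ?thesis using m0[OF that(1)] by linarith
  qed
  then show ?thesis using that by blast
qed

section \<open>Estimates in Stolz angles\<close>

text \<open>On the circle only the vertex \<open>\<zeta>\<close> satisfies the inequality, so this is a Stolz angle together with its
vertex. Continuity on this set then expresses at once that a nontangential limit exists and that it
is the value at \<open>\<zeta>\<close>.\<close>

definition closed_Stolz :: "complex \<Rightarrow> real \<Rightarrow> complex set"
  where "closed_Stolz \<zeta> M = {z. cmod z \<le> 1 \<and> cmod (z - \<zeta>) \<le> M * (1 - cmod z)}"

text \<open>If \<open>1 - \<bar>z\<bar>\<close> is small compared with \<open>\<epsilon> / (n M)\<close>, then \<open>\<bar>z - \<zeta>\<bar>\<close> is small compared with \<open>\<epsilon> / n\<close>, and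
\<open>z ^ n\<close> is close to \<open>\<zeta> ^ n\<close>. Otherwise \<open>\<bar>z ^ n\<bar>\<close> is bounded away from \<open>1\<close>. The point is that the bound does not depend
on \<open>n\<close>.\<close>

lemma one_minus_power_lower_bound_Stolz:
  assumes z: "z \<in> closed_Stolz \<zeta> M" and M: "1 \<le> M" and \<zeta>: "cmod \<zeta> = 1"
    and \<epsilon>: "\<epsilon> \<le> cmod (1 - \<zeta> ^ n)" "0 < \<epsilon>" "\<epsilon> \<le> 1"
  shows "\<epsilon> / (4 * M) \<le> cmod (1 - z ^ n)"
proof (cases "real n * (1 - cmod z) * M \<le> \<epsilon> / 2")
  case True
  have "cmod (z ^ n - \<zeta> ^ n) \<le> real n * cmod (z - \<zeta>)"
    using z \<zeta> by (intro norm_power_diff) (auto simp: closed_Stolz_def)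
  also have "\<dots> \<le> real n * (M * (1 - cmod z))"
    using z by (intro mult_left_mono) (auto simp: closed_Stolz_def)
  also have "\<dots> \<le> \<epsilon> / 2" using True by (simp add: algebra_simps)
  finally have "cmod (z ^ n - \<zeta> ^ n) \<le> \<epsilon> / 2" .
  moreover have "cmod (1 - \<zeta> ^ n) \<le> cmod (1 - z ^ n) + cmod (z ^ n - \<zeta> ^ n)"
    using norm_triangle_ineq[of "1 - z ^ n" "z ^ n - \<zeta> ^ n"] by simp
  ultimately have "\<epsilon> / 2 \<le> cmod (1 - z ^ n)" using \<epsilon> by linarith
  moreover have "\<epsilon> / (4 * M) \<le> \<epsilon> / 2" using \<epsilon> M by (intro divide_left_mono) auto
  ultimately show ?thesis by linarith
next
  case False
  define \<delta> where "\<delta> = \<epsilon> / (2 * M)"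
  define x where "x = 1 - cmod z"
  have \<delta>: "0 < \<delta>" "\<delta> \<le> 1" "\<delta> \<le> real n * x"
    using \<epsilon> M False by (auto simp: \<delta>_def x_def field_simps)
  have x: "0 \<le> x" "x \<le> 1" using z by (auto simp: x_def closed_Stolz_def)
  have "(1 - x) ^ n * (1 + \<delta>) \<le> (1 - x) ^ n * (1 + x) ^ n"
  proof (rule mult_left_mono)
    \<comment> \<open>Bernoulli applied to \<open>1 + x\<close>: \<open>(1 - x) ^ n \<le> 1 / (1 + x) ^ n \<le> 1 / (1 + n x)\<close>.\<close>
    have "1 + real n * x \<le> (1 + x) ^ n"
      using Bernoulli_inequality[of x n] x by simp
    then show "1 + \<delta> \<le> (1 + x) ^ n" using \<delta> by linarith
  qed (use x in auto)
  also have "\<dots> = (1 - x\<^sup>2) ^ n"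
    by (simp add: power_mult_distrib[symmetric] power2_eq_square algebra_simps)
  also have "\<dots> \<le> 1"
    using x by (intro power_le_one) (auto simp: power_le_one)
  finally have "(1 - x) ^ n \<le> 1 / (1 + \<delta>)"
    using \<delta> by (simp add: field_simps)
  then have "cmod (z ^ n) \<le> 1 / (1 + \<delta>)" by (simp add: norm_power x_def)
  moreover have "1 - 1 / (1 + \<delta>) \<ge> \<delta> / 2"
  proof -
    have "\<delta> * \<delta> \<le> \<delta> * 1" using \<delta> by (intro mult_left_mono) auto
    then show ?thesis using \<delta> by (simp add: field_simps)
  qed
  moreover have "1 - cmod (z ^ n) \<le> cmod (1 - z ^ n)"
    using norm_triangle_ineq2[of 1 "z ^ n"] by simp
  moreover have "\<delta> / 2 = \<epsilon> / (4 * M)" by (simp add: \<delta>_def)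
  ultimately show ?thesis by linarith
qed

lemma boundary_piece_continuous_on:
  assumes "continuous_on UNIV P"
  shows "continuous_on {z. z ^ Suc (K + m) \<noteq> 1} (boundary_piece K P m)"
proof -
  have "continuous_on {z. z ^ Suc (K + m) \<noteq> 1} P"
    using assms by (rule continuous_on_subset) simp
  then show ?thesis
    unfolding boundary_piece_def by (intro continuous_intros) simp_all
qed

lemma boundary_piece_Stolz_bound:
  assumes z: "z \<in> closed_Stolz \<zeta> M" and M: "1 \<le> M" and \<zeta>: "cmod \<zeta> = 1"
    and \<epsilon>: "\<epsilon> \<le> cmod (1 - \<zeta> ^ Suc (K + m))" "0 < \<epsilon>" "\<epsilon> \<le> 1"
  shows "cmod (boundary_piece K P m z) \<le> 8 * M / \<epsilon> * cmod (P z)"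
proof -
  have "cmod (z ^ m) \<le> 1"
    using z by (auto simp: closed_Stolz_def norm_power intro: power_le_one)
  then have "cmod (- 2 * z ^ m * P z) \<le> 2 * cmod (P z)"
    by (simp add: norm_mult mult_left_le_one_le)
  then have "cmod (boundary_piece K P m z) \<le> 2 * cmod (P z) / (\<epsilon> / (4 * M))"
    unfolding boundary_piece_def norm_divide
    using one_minus_power_lower_bound_Stolz[OF z M \<zeta> \<epsilon>] \<epsilon> M
    by (intro frac_le) auto
  then show ?thesis by (simp add: mult_ac)
qed

text \<open>All that the construction uses about a summand: \<open>q\<close> is the boundary value of \<open>Re (\<zeta> * G \<zeta>)\<close>, the
number \<open>k\<close> of the summand fixes how much of the disc and how wide a Stolz angle is under control, and
\<open>\<epsilon>\<close> is the distance that \<open>\<zeta> ^ N\<close> has to keep from \<open>1\<close>.\<close>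

definition small_piece ::
    "(complex \<Rightarrow> real) \<Rightarrow> real \<Rightarrow> real \<Rightarrow> nat \<Rightarrow> nat \<Rightarrow> (complex \<Rightarrow> complex) \<Rightarrow> bool"
  where "small_piece q \<epsilon> c k N G \<longleftrightarrow>
    0 < N \<and> G holomorphic_on ball 0 1 \<and> continuous_on {z. z ^ N \<noteq> 1} G \<and>
    (\<forall>\<zeta>. cmod \<zeta> = 1 \<longrightarrow> \<zeta> ^ N \<noteq> 1 \<longrightarrow> Re (\<zeta> * G \<zeta>) = q \<zeta>) \<and>
    (\<forall>z. cmod z \<le> 1 - 1 / (real k + 1) \<longrightarrow> cmod (G z) \<le> c) \<and>
    (\<forall>\<zeta> M z. cmod \<zeta> = 1 \<longrightarrow> \<epsilon> \<le> cmod (1 - \<zeta> ^ N) \<longrightarrow> 1 \<le> M \<longrightarrow> M \<le> real k + 1 \<longrightarrow>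
      z \<in> closed_Stolz \<zeta> M \<longrightarrow> cmod (G z) \<le> c + 8 * M / \<epsilon> * (\<bar>q \<zeta>\<bar> + c))"

text \<open>In a Stolz angle at \<open>\<zeta>\<close>, a point either is so close to \<open>\<zeta>\<close> that \<open>P\<close> hardly differs from \<open>P \<zeta>\<close>, whose
modulus is \<open>\<bar>q \<zeta>\<bar>\<close>, or stays in a disc of radius \<open>r < 1\<close> which is the same for all \<open>\<zeta>\<close>. In that disc
the function is made small by the choice of \<open>m\<close>, which comes after that of \<open>r\<close>.\<close>

lemma exists_small_piece:
  assumes q: "real_polynomial_function (q :: complex \<Rightarrow> real)"
    and \<epsilon>: "0 < \<epsilon>" "\<epsilon> \<le> 1" and c: "0 < c"
  shows "\<exists>N G. small_piece q \<epsilon> c k N G"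
proof -
  obtain K P where P: "P holomorphic_on UNIV"
      "\<And>\<zeta>. cmod \<zeta> = 1 \<Longrightarrow> P \<zeta> = \<zeta> ^ K * of_real (q \<zeta>)"
    using real_polynomial_on_circle[OF q] by blast
  have contP: "continuous_on UNIV P"
    using P(1) holomorphic_on_imp_continuous_on by blast
  have "uniformly_continuous_on (cball 0 1) P"
    using contP by (intro compact_uniformly_continuous) (auto intro: continuous_on_subset)
  then obtain \<eta>' where \<eta>': "0 < \<eta>'"
      "\<And>z w. cmod z \<le> 1 \<Longrightarrow> cmod w \<le> 1 \<Longrightarrow> dist z w < \<eta>' \<Longrightarrow> dist (P z) (P w) < c"
    unfolding uniformly_continuous_on_def using c by (metis dist_0_norm mem_cball)
  \<comment> \<open>With \<open>\<eta> \<le> 1\<close> the radius \<open>r\<close> below is at least \<open>1 - 1 / (k + 1)\<close>; the denominator absorbs all \<open>M \<le> k + 1\<close>.\<close>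
  define \<eta> where "\<eta> = min \<eta>' 1"
  have \<eta>: "0 < \<eta>" "\<eta> \<le> 1" "\<eta> \<le> \<eta>'" using \<eta>' by (auto simp: \<eta>_def)
  define r where "r = 1 - \<eta> / (real k + 1)"
  have r: "0 \<le> r" "r < 1" using \<eta> by (auto simp: r_def field_simps)
  obtain m where m: "\<And>z. cmod z \<le> r \<Longrightarrow> cmod (boundary_piece K P m z) \<le> c"
    using boundary_piece_small[OF contP r c, of K] by (metis order_refl)
  define N where "N = Suc (K + m)"
  define G where "G = boundary_piece K P m"
  have small: "cmod (G z) \<le> c" if "cmod z \<le> 1 - 1 / (real k + 1)" for z
  proof -
    have "\<eta> / (real k + 1) \<le> 1 / (real k + 1)" using \<eta> by (intro divide_right_mono) auto
    then show ?thesis using m that by (auto simp: G_def r_def)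
  qed
  have stolz: "cmod (G z) \<le> c + 8 * M / \<epsilon> * (\<bar>q \<zeta>\<bar> + c)"
    if \<zeta>: "cmod \<zeta> = 1" and far: "\<epsilon> \<le> cmod (1 - \<zeta> ^ N)" and M: "1 \<le> M" "M \<le> real k + 1"
      and z: "z \<in> closed_Stolz \<zeta> M" for \<zeta> M z
  proof (cases "cmod z \<le> r")
    case True
    then have "cmod (G z) \<le> c" using m by (simp add: G_def)
    moreover have "0 \<le> 8 * M / \<epsilon> * (\<bar>q \<zeta>\<bar> + c)" using M \<epsilon> c by simp
    ultimately show ?thesis by linarith
  next
    case False
    then have "1 - cmod z < \<eta> / (real k + 1)" by (simp add: r_def)
    then have "(real k + 1) * (1 - cmod z) < \<eta>" by (simp add: field_simps)
    moreover have "M * (1 - cmod z) \<le> (real k + 1) * (1 - cmod z)"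
      using M z by (intro mult_right_mono) (auto simp: closed_Stolz_def)
    ultimately have "dist z \<zeta> < \<eta>'"
      using z \<eta>(3) by (auto simp: closed_Stolz_def dist_norm)
    then have "dist (P z) (P \<zeta>) < c"
      using \<eta>' \<zeta> z by (auto simp: closed_Stolz_def)
    moreover have "cmod (P z) \<le> cmod (P \<zeta>) + dist (P z) (P \<zeta>)"
      by (metis dist_norm norm_triangle_sub)
    moreover have "cmod (P \<zeta>) = \<bar>q \<zeta>\<bar>"
      using P(2)[OF \<zeta>] \<zeta> by (simp add: norm_mult norm_power)
    ultimately have "cmod (P z) \<le> \<bar>q \<zeta>\<bar> + c" by linarith
    then have "8 * M / \<epsilon> * cmod (P z) \<le> 8 * M / \<epsilon> * (\<bar>q \<zeta>\<bar> + c)"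
      using M \<epsilon> by (intro mult_left_mono) auto
    then show ?thesis
      using boundary_piece_Stolz_bound[OF z M(1) \<zeta> far[unfolded N_def] \<epsilon>, of P] c
      by (simp add: G_def)
  qed
  show ?thesis
    unfolding small_piece_def
  proof (intro exI[of _ N] exI[of _ G] conjI allI impI)
    show "0 < N" by (simp add: N_def)
    show "G holomorphic_on ball 0 1"
      unfolding G_def by (rule boundary_piece_holomorphic[OF P(1)])
    show "continuous_on {z. z ^ N \<noteq> 1} G"
      unfolding G_def N_def by (rule boundary_piece_continuous_on[OF contP])
    show "Re (\<zeta> * G \<zeta>) = q \<zeta>" if "cmod \<zeta> = 1" "\<zeta> ^ N \<noteq> 1" for \<zeta>
      unfolding G_def using that P(2)[OF that(1)] unfolding N_def by (rule Re_boundary_piece)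
  qed (use small stolz in auto)
qed

lemma closed_Stolz_power_neq_1:
  assumes "z \<in> closed_Stolz \<zeta> M" "0 < N" "\<zeta> ^ N \<noteq> 1"
  shows "z ^ N \<noteq> 1"
proof
  assume *: "z ^ N = 1"
  then have "cmod z = 1"
    using power_eq_imp_eq_base[of "cmod z" N 1] assms(2) by (simp flip: norm_power)
  then have "z = \<zeta>" using assms(1) by (simp add: closed_Stolz_def)
  then show False using * assms by simp
qed

section \<open>The series\<close>

text \<open>The boundary value \<open>s\<close> is written as the telescoping series of the differences \<open>S (Suc k) - S k\<close>, and
each difference is realised by one summand. If they decay like \<open>4 ^ (-k)\<close> while
\<open>\<bar>1 - \<zeta> ^ N k\<bar> \<ge> 2 ^ (-k-1)\<close>, then the summands are bounded
by a multiple of \<open>2 ^ (-k)\<close> in every Stolz angle, so that the series converges uniformly up to the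
vertex.\<close>

lemma holomorphic_with_boundary_series:
  assumes S: "\<And>k. real_polynomial_function (S k :: complex \<Rightarrow> real)" and S0: "\<And>z. S 0 z = 0"
  obtains N g where "\<And>k::nat. 0 < N k" "g holomorphic_on ball 0 1"
    "\<And>\<zeta> s. cmod \<zeta> = 1 \<Longrightarrow> (\<And>k. \<zeta> ^ N k \<noteq> 1) \<Longrightarrow>
      \<forall>\<^sub>F k in sequentially. (1 / 2) ^ Suc k \<le> cmod (1 - \<zeta> ^ N k) \<Longrightarrow>
      \<forall>\<^sub>F k in sequentially. \<bar>S (Suc k) \<zeta> - S k \<zeta>\<bar> \<le> 2 * (1 / 4) ^ k \<Longrightarrow>
      (\<lambda>k. S k \<zeta>) \<longlonglongrightarrow> s \<Longrightarrow>
      (\<forall>M\<ge>1. continuous_on (closed_Stolz \<zeta> M) g) \<and> Re (\<zeta> * g \<zeta>) = s"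
proof -
  define q where "q = (\<lambda>k z. S (Suc k) z - S k z)"
  define e c :: "nat \<Rightarrow> real" where "e = (\<lambda>k. (1 / 2) ^ Suc k)" and "c = (\<lambda>k. (1 / 4) ^ k)"
  have ec: "0 < e k" "e k \<le> 1" "0 < c k" for k
    unfolding e_def c_def by (auto intro!: power_le_one simp del: power_Suc)
  have "real_polynomial_function (q k)" for k
    unfolding q_def by (intro real_polynomial_function_diff S)
  then have "\<exists>N G. small_piece (q k) (e k) (c k) k N G" for k
    using ec by (rule exists_small_piece)
  then obtain N G where NG: "\<And>k. small_piece (q k) (e k) (c k) k (N k) (G k)"
    by metis
  have N: "\<And>k. 0 < N k" and hol: "\<And>k. G k holomorphic_on ball 0 1"
    and cont: "\<And>k. continuous_on {z. z ^ N k \<noteq> 1} (G k)"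
    and bdry: "\<And>k \<zeta>. cmod \<zeta> = 1 \<Longrightarrow> \<zeta> ^ N k \<noteq> 1 \<Longrightarrow> Re (\<zeta> * G k \<zeta>) = q k \<zeta>"
    and small: "\<And>k z. cmod z \<le> 1 - 1 / (real k + 1) \<Longrightarrow> cmod (G k z) \<le> c k"
    and stolz: "\<And>k \<zeta> M z. cmod \<zeta> = 1 \<Longrightarrow> e k \<le> cmod (1 - \<zeta> ^ N k) \<Longrightarrow> 1 \<le> M \<Longrightarrow> M \<le> real k + 1 \<Longrightarrow>
      z \<in> closed_Stolz \<zeta> M \<Longrightarrow> cmod (G k z) \<le> c k + 8 * M / e k * (\<bar>q k \<zeta>\<bar> + c k)"
    using NG unfolding small_piece_def by blast+
  define g where "g = (\<lambda>z. \<Sum>k. G k z)"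
  have "g holomorphic_on ball 0 1"
  proof (rule holomorphic_uniform_sequence[of _ "\<lambda>n z. \<Sum>k<n. G k z"])
    show "(\<lambda>z. \<Sum>k<n. G k z) holomorphic_on ball 0 1" for n
      by (intro holomorphic_on_sum hol)
    show "\<exists>d>0. cball x d \<subseteq> ball 0 1 \<and> uniform_limit (cball x d) (\<lambda>n z. \<Sum>k<n. G k z) g sequentially"
      if x: "x \<in> ball 0 1" for x
    proof -
      define d where "d = (1 - cmod x) / 2"
      have d: "0 < d" "cmod x + d < 1" using x by (auto simp: d_def field_simps)
      have in_d: "cmod z \<le> cmod x + d" if "z \<in> cball x d" for z
        using that norm_triangle_ineq2[of z x] by (simp add: dist_norm norm_minus_commute)
      have "uniform_limit (cball x d) (\<lambda>n z. \<Sum>k<n. G k z) g sequentially"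
        unfolding g_def
      proof (rule Weierstrass_m_test_ev)
        have "(\<lambda>k. 1 - 1 / (real k + 1)) \<longlonglongrightarrow> 1" by real_asymp
        then have "\<forall>\<^sub>F k in sequentially. cmod x + d < 1 - 1 / (real k + 1)"
          using d(2) by (rule order_tendstoD(1))
        then show "\<forall>\<^sub>F k in sequentially. \<forall>z\<in>cball x d. cmod (G k z) \<le> c k"
          by eventually_elim (meson in_d small less_imp_le order_trans)
        show "summable c" unfolding c_def by (rule summable_geometric) simp
      qed
      moreover have "cball x d \<subseteq> ball 0 1" using in_d d(2) by force
      ultimately show ?thesis using d(1) by blast
    qed
  qed auto
  moreover have "(\<forall>M\<ge>1. continuous_on (closed_Stolz \<zeta> M) g) \<and> Re (\<zeta> * g \<zeta>) = s"
    if \<zeta>: "cmod \<zeta> = 1" and ne: "\<And>k. \<zeta> ^ N k \<noteq> 1"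
      and far: "\<forall>\<^sub>F k in sequentially. (1 / 2) ^ Suc k \<le> cmod (1 - \<zeta> ^ N k)"
      and near: "\<forall>\<^sub>F k in sequentially. \<bar>S (Suc k) \<zeta> - S k \<zeta>\<bar> \<le> 2 * (1 / 4) ^ k"
      and lim: "(\<lambda>k. S k \<zeta>) \<longlonglongrightarrow> s" for \<zeta> s
  proof -
    have unif: "uniform_limit (closed_Stolz \<zeta> M) (\<lambda>n z. \<Sum>k<n. G k z) g sequentially"
      if M: "1 \<le> M" for M
      unfolding g_def
    proof (rule Weierstrass_m_test_ev)
      have "\<forall>\<^sub>F k in sequentially. M \<le> real k + 1" by real_asymp
      with far near show "\<forall>\<^sub>F k in sequentially. \<forall>z\<in>closed_Stolz \<zeta> M.
          cmod (G k z) \<le> c k + 48 * M * (1 / 2) ^ k"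
      proof eventually_elim
        case (elim k)
        have "8 * M / e k * (\<bar>q k \<zeta>\<bar> + c k) \<le> 8 * M / e k * (3 * c k)"
          using elim(2) M ec[of k] by (intro mult_left_mono) (auto simp: q_def c_def)
        also have "\<dots> = 48 * M * (1 / 2) ^ k"
        proof -
          have "((1::real) / 4) ^ k = (1 / 2) ^ k * (1 / 2) ^ k"
            by (simp add: power_mult_distrib[symmetric])
          then show ?thesis by (simp add: c_def e_def)
        qed
        finally show ?case
          using stolz[OF \<zeta> _ M elim(3)] elim(1) unfolding e_def by fastforce
      qed
      show "summable (\<lambda>k. c k + 48 * M * (1 / 2) ^ k)"
        unfolding c_def by (intro summable_add summable_mult summable_geometric) auto
    qed
    have "continuous_on (closed_Stolz \<zeta> M) g" if M: "1 \<le> M" for M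
    proof (rule uniform_limit_theorem[OF _ unif[OF M]])
      have "continuous_on (closed_Stolz \<zeta> M) (G k)" for k
        by (rule continuous_on_subset[OF cont]) (use closed_Stolz_power_neq_1 N ne in blast)
      then show "\<forall>\<^sub>F n in sequentially. continuous_on (closed_Stolz \<zeta> M) (\<lambda>z. \<Sum>k<n. G k z)"
        by (intro always_eventually allI continuous_on_sum) auto
    qed simp
    moreover have "Re (\<zeta> * g \<zeta>) = s"
    proof (rule LIMSEQ_unique)
      have "\<zeta> \<in> closed_Stolz \<zeta> 1" using \<zeta> by (simp add: closed_Stolz_def)
      then have "(\<lambda>n. \<Sum>k<n. G k \<zeta>) \<longlonglongrightarrow> g \<zeta>"
        using tendsto_uniform_limitI[OF unif[of 1]] by simp
      then show "(\<lambda>n. Re (\<zeta> * (\<Sum>k<n. G k \<zeta>))) \<longlonglongrightarrow> Re (\<zeta> * g \<zeta>)"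
        by (intro tendsto_intros)
      have "Re (\<zeta> * (\<Sum>k<n. G k \<zeta>)) = S n \<zeta>" for n
      proof -
        have "Re (\<zeta> * (\<Sum>k<n. G k \<zeta>)) = (\<Sum>k<n. Re (\<zeta> * G k \<zeta>))"
          by (simp only: sum_distrib_left Re_sum)
        also have "\<dots> = (\<Sum>k<n. S (Suc k) \<zeta> - S k \<zeta>)"
          using bdry[OF \<zeta> ne] by (simp only: q_def)
        also have "\<dots> = S n \<zeta>" using sum_lessThan_telescope[of "\<lambda>k. S k \<zeta>" n] S0 by (simp only: diff_zero)
        finally show ?thesis .
      qed
      then show "(\<lambda>n. Re (\<zeta> * (\<Sum>k<n. G k \<zeta>))) \<longlonglongrightarrow> s" using lim by simp
    qed
    ultimately show ?thesis by blast
  qed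
  ultimately show ?thesis using that N by blast
qed

section \<open>From the derivative to the harmonic function\<close>

lemma dir_deriv_eqI:
  assumes "(f has_derivative f') (at z)"
  shows "dir_deriv v f z = f' v"
  unfolding dir_deriv_def frechet_derivative_at[OF assms, symmetric] ..

lemma Re_holomorphic_has_derivative:
  assumes "(F has_field_derivative F') (at z)"
  shows "((\<lambda>z. - Re (c * F z)) has_derivative (\<lambda>v. - Re (c * F' * v))) (at z)"
proof -
  have "((\<lambda>z. c * F z) has_derivative (\<lambda>v. c * F' * v)) (at z)"
    using DERIV_cmult[OF assms, of c] by (simp only: has_field_derivative_def)
  from has_derivative_minus[OF bounded_linear.has_derivative[OF bounded_linear_Re this]]
  show ?thesis .
qed

text \<open>The factor \<open>c\<close> makes the lemma apply twice: to the function \<open>- Re F\<close> itself, with \<open>c = 1\<close>, and to its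
derivative in a fixed direction \<open>v\<close>, which is \<open>- Re (v * g)\<close>.\<close>

lemma C1_on_ReI:
  assumes F: "\<And>z. z \<in> ball 0 1 \<Longrightarrow> (F has_field_derivative F' z) (at z)"
    and F': "continuous_on (ball 0 1) F'"
    and u: "\<And>z. z \<in> ball 0 1 \<Longrightarrow> u z = - Re (c * F z)"
  shows "C1_on (ball 0 1) u"
    and "z \<in> ball 0 1 \<Longrightarrow> dir_deriv v u z = - Re (c * F' z * v)"
proof -
  have D: "(u has_derivative (\<lambda>v. - Re (c * F' z * v))) (at z)" if z: "z \<in> ball 0 1" for z
    using Re_holomorphic_has_derivative[OF F[OF z]] open_ball z
    by (rule has_derivative_transform_within_open) (simp add: u)
  then have dir: "dir_deriv v u z = - Re (c * F' z * v)" if "z \<in> ball 0 1" for z v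
    using that by (intro dir_deriv_eqI) auto
  then show "z \<in> ball 0 1 \<Longrightarrow> dir_deriv v u z = - Re (c * F' z * v)" .
  have "continuous_on (ball 0 1) (dir_deriv v u)" for v
  proof -
    have "continuous_on (ball 0 1) (\<lambda>z. - Re (c * F' z * v))"
      by (intro continuous_intros F')
    then show ?thesis by (rule continuous_on_eq) (simp only: dir)
  qed
  moreover have "u differentiable (at z)" if "z \<in> ball 0 1" for z
    using D[OF that] by (rule differentiableI)
  ultimately show "C1_on (ball 0 1) u"
    unfolding C1_on_def by blast
qed

lemma harmonic_minus_Re_primitive:
  assumes F: "\<And>z. z \<in> ball 0 1 \<Longrightarrow> (F has_field_derivative g z) (at z)"
    and g: "g holomorphic_on ball 0 1"
  shows "harmonic_function_on (ball 0 1) (\<lambda>z. - Re (F z))"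
    and "z \<in> ball 0 1 \<Longrightarrow> dir_deriv v (\<lambda>z. - Re (F z)) z = - Re (g z * v)"
proof -
  let ?u = "\<lambda>z. - Re (F z)"
  have g': "(g has_field_derivative deriv g z) (at z)" if "z \<in> ball 0 1" for z
    using holomorphic_derivI[OF g open_ball that] .
  have cont: "continuous_on (ball 0 1) g" "continuous_on (ball 0 1) (deriv g)"
    using g holomorphic_deriv[OF g open_ball] holomorphic_on_imp_continuous_on by auto
  have first: "C1_on (ball 0 1) ?u"
    "\<And>z v. z \<in> ball 0 1 \<Longrightarrow> dir_deriv v ?u z = - Re (g z * v)"
    using C1_on_ReI[OF F cont(1), of ?u 1] by auto
  then show "z \<in> ball 0 1 \<Longrightarrow> dir_deriv v ?u z = - Re (g z * v)" by blast
  have dv: "dir_deriv v ?u z = - Re (v * g z)" if "z \<in> ball 0 1" for z v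
    using first(2)[OF that] by (simp only: mult.commute)
  note second = C1_on_ReI[OF g' cont(2) dv]
  show "harmonic_function_on (ball 0 1) ?u"
    unfolding harmonic_function_on_def C2_on_def
  proof (intro conjI allI ballI)
    show "dir_deriv 1 (dir_deriv 1 ?u) z + dir_deriv \<i> (dir_deriv \<i> ?u) z = 0"
      if z: "z \<in> ball 0 1" for z
      by (simp only: second(2)[OF _ _ z]) simp
  qed (use first second in auto)
qed

lemma closed_Stolz_radius:
  assumes "cmod \<zeta> = 1" "0 \<le> r" "r \<le> 1"
  shows "of_real r * \<zeta> \<in> closed_Stolz \<zeta> 1"
proof -
  have "of_real r * \<zeta> - \<zeta> = of_real (r - 1) * \<zeta>" by (simp add: algebra_simps)
  then have "cmod (of_real r * \<zeta> - \<zeta>) = 1 - r"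
    using assms by (simp only: norm_mult norm_of_real) simp
  then show ?thesis using assms by (simp add: closed_Stolz_def norm_mult)
qed

text \<open>Nothing is known about \<open>F\<close> on the circle, but along a radius it agrees with a primitive of a function
that is continuous up to the endpoint. This yields the radial limit and the
one-sided derivative there together.\<close>

lemma radial_primitive:
  assumes F: "\<And>z. z \<in> ball 0 1 \<Longrightarrow> (F has_field_derivative g z) (at z)"
    and \<zeta>: "cmod \<zeta> = 1" and g: "continuous_on (closed_Stolz \<zeta> 1) g"
  obtains C where "\<And>r. 0 \<le> r \<Longrightarrow> r < 1 \<Longrightarrow> F (of_real r * \<zeta>) = C r"
    "(C has_vector_derivative \<zeta> * g \<zeta>) (at 1 within {0..1})"
proof -
  have sub: "of_real r * \<zeta> \<in> closed_Stolz \<zeta> 1" if "r \<in> {0..1}" for r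
    using closed_Stolz_radius[OF \<zeta>] that by simp
  have "continuous_on {0..1} (\<lambda>r. \<zeta> * g (of_real r * \<zeta>))"
    by (intro continuous_intros continuous_on_compose2[OF g]) (use sub in auto)
  then obtain C where C: "\<And>r. r \<in> {0..1} \<Longrightarrow>
      (C has_vector_derivative \<zeta> * g (of_real r * \<zeta>)) (at r within {0..1})"
    by (rule antiderivative_continuous) blast
  have "((\<lambda>r. F (of_real r * \<zeta>) - C r) has_vector_derivative 0) (at r within {0..<1})"
    if r: "r \<in> {0..<1}" for r
  proof -
    have "((\<lambda>r. of_real r * \<zeta>) has_vector_derivative \<zeta>) (at r within {0..<1})"
      by (auto intro!: derivative_eq_intros simp: has_vector_derivative_def scaleR_conv_of_real)
    moreover have "(F has_field_derivative g (of_real r * \<zeta>)) (at (of_real r * \<zeta>) within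
        (\<lambda>r. of_real r * \<zeta>) ` {0..<1})"
      using r \<zeta> by (intro has_field_derivative_at_within[OF F]) (simp add: norm_mult)
    ultimately have "((F \<circ> (\<lambda>r. of_real r * \<zeta>)) has_vector_derivative \<zeta> * g (of_real r * \<zeta>))
        (at r within {0..<1})"
      by (rule field_vector_diff_chain_within)
    moreover have "(C has_vector_derivative \<zeta> * g (of_real r * \<zeta>)) (at r within {0..<1})"
      using C[of r] r by (auto intro: has_vector_derivative_within_subset)
    ultimately show ?thesis
      using has_vector_derivative_diff[of "F \<circ> (\<lambda>r. of_real r * \<zeta>)"] by (force simp: o_def)
  qed
  then obtain k where k: "\<And>r. r \<in> {0..<1} \<Longrightarrow> F (of_real r * \<zeta>) - C r = k"
    using has_vector_derivative_zero_constant[of "{0..<1}" "\<lambda>r. F (of_real r * \<zeta>) - C r"]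
    by auto
  show ?thesis
  proof (rule that[of "\<lambda>r. C r + k"])
    show "F (of_real r * \<zeta>) = C r + k" if "0 \<le> r" "r < 1" for r
      using k[of r] that by (simp add: algebra_simps)
    show "((\<lambda>r. C r + k) has_vector_derivative \<zeta> * g \<zeta>) (at 1 within {0..1})"
      using C[of 1] by (simp add: has_vector_derivative_add_const)
  qed
qed

lemma radial_limit_and_normal_derivative:
  assumes F: "\<And>z. z \<in> ball 0 1 \<Longrightarrow> (F has_field_derivative g z) (at z)"
    and \<zeta>: "cmod \<zeta> = 1" and g: "continuous_on (closed_Stolz \<zeta> 1) g"
    and u: "\<And>z. u z = - Re (F z)"
  obtains u1 where "((\<lambda>r. u (of_real r * \<zeta>)) \<longlongrightarrow> u1) (at_left 1)"
    "((\<lambda>t. (u (\<zeta> + of_real t * interior_normal \<zeta>) - u1) / t) \<longlongrightarrow> Re (\<zeta> * g \<zeta>)) (at_right 0)"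
proof -
  obtain C where C: "\<And>r. 0 \<le> r \<Longrightarrow> r < 1 \<Longrightarrow> F (of_real r * \<zeta>) = C r"
    and C': "(C has_vector_derivative \<zeta> * g \<zeta>) (at 1 within {0..1})"
    using radial_primitive[OF F \<zeta> g] by blast
  define R where "R = (\<lambda>r. - Re (C r))"
  have left: "at (1::real) within {0..1} = at_left 1"
    by (intro at_within_Icc_at_left) simp
  have "(R has_vector_derivative - Re (\<zeta> * g \<zeta>)) (at_left 1)"
    unfolding R_def left[symmetric]
    by (intro has_vector_derivative_minus
        bounded_linear.has_vector_derivative[OF bounded_linear_Re C'])
  then have R': "(R has_field_derivative - Re (\<zeta> * g \<zeta>)) (at_left 1)"
    by (simp add: has_real_derivative_iff_has_vector_derivative)
  have ev: "\<forall>\<^sub>F r in at_left (1::real). u (of_real r * \<zeta>) = R r"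
  proof -
    have "\<forall>\<^sub>F r in at_left (1::real). r \<in> {0<..<1}"
      by (rule eventually_at_left_real) simp
    then show ?thesis by eventually_elim (simp add: u R_def C)
  qed
  have "(R \<longlongrightarrow> R 1) (at_left 1)"
    using DERIV_continuous[OF R'] by (simp add: continuous_within)
  then have 1: "((\<lambda>r. u (of_real r * \<zeta>)) \<longlongrightarrow> R 1) (at_left 1)"
    by (rule Lim_transform_eventually) (use ev in \<open>simp add: eq_commute\<close>)
  have "((\<lambda>r. (R r - R 1) / (r - 1)) \<longlongrightarrow> - Re (\<zeta> * g \<zeta>)) (at_left 1)"
    using R' by (simp add: has_field_derivative_iff)
  then have "((\<lambda>r. - ((R r - R 1) / (r - 1))) \<longlongrightarrow> Re (\<zeta> * g \<zeta>)) (at_left 1)"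
    using tendsto_minus[of "\<lambda>r. (R r - R 1) / (r - 1)" "- Re (\<zeta> * g \<zeta>)"] by (simp only: minus_minus)
  moreover have "filterlim (\<lambda>t::real. 1 - t) (at_left 1) (at_right 0)"
    by real_asymp
  ultimately have "((\<lambda>t. - ((R (1 - t) - R 1) / ((1 - t) - 1))) \<longlongrightarrow> Re (\<zeta> * g \<zeta>)) (at_right 0)"
    by (rule filterlim_compose)
  moreover have "\<forall>\<^sub>F t in at_right (0::real). - ((R (1 - t) - R 1) / ((1 - t) - 1)) =
      (u (\<zeta> + of_real t * interior_normal \<zeta>) - R 1) / t"
  proof -
    have "\<forall>\<^sub>F t in at_right (0::real). t \<in> {0<..<1}"
      by (rule eventually_at_right_real) simp
    then show ?thesis
    proof eventually_elim
      case (elim t)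
      have "\<zeta> + of_real t * interior_normal \<zeta> = of_real (1 - t) * \<zeta>"
        by (simp add: interior_normal_def algebra_simps)
      then have "u (\<zeta> + of_real t * interior_normal \<zeta>) = R (1 - t)"
        using elim C[of "1 - t"] by (simp only: u R_def) simp
      then show ?case by (simp add: field_simps)
    qed
  qed
  ultimately have "((\<lambda>t. (u (\<zeta> + of_real t * interior_normal \<zeta>) - R 1) / t) \<longlongrightarrow> Re (\<zeta> * g \<zeta>)) (at_right 0)"
    by (rule Lim_transform_eventually)
  with 1 show ?thesis using that by blast
qed

lemma infdist_unit_circle:
  assumes "z \<in> ball (0::complex) 1"
  shows "infdist z (sphere 0 1) \<le> 1 - cmod z"
proof -
  obtain w where w: "cmod w = 1" "z = of_real (cmod z) * w"
  proof (cases "z = 0")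
    case True
    then show ?thesis using that[of 1] by simp
  next
    case False
    then show ?thesis using that[of "z / of_real (cmod z)"] by (simp add: norm_divide)
  qed
  have "z - w = of_real (cmod z - 1) * w" using w(2) by (simp add: algebra_simps)
  then have "dist z w = 1 - cmod z"
    using assms w(1) by (simp only: dist_norm norm_mult norm_of_real) simp
  then show ?thesis using w(1) infdist_le[of w "sphere 0 1" z] by simp
qed

text \<open>Any path that ends at \<open>\<zeta>\<close> inside a Stolz angle stays in a closed one, where continuity of \<open>h\<close> at the
vertex gives the limit.\<close>

lemma nontangential_limit_from_closed_Stolz:
  assumes \<zeta>: "cmod \<zeta> = 1" and cont: "\<And>M. 1 \<le> M \<Longrightarrow> continuous_on (closed_Stolz \<zeta> M) h"
    and eq: "\<And>z. z \<in> ball 0 1 \<Longrightarrow> v z = h z"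
  shows "has_nontangential_limit v (h \<zeta>) \<zeta>"
  unfolding has_nontangential_limit_def
proof (intro allI impI)
  fix \<gamma> assume \<gamma>: "nontangential_path \<zeta> \<gamma>"
  then obtain M' where M': "\<forall>\<^sub>F t in at_left 1. \<gamma> t \<in> Stolz_angle \<zeta> M'"
    unfolding nontangential_path_def by blast
  define M where "M = max 1 M'"
  have sub: "Stolz_angle \<zeta> M' \<subseteq> closed_Stolz \<zeta> M"
  proof
    fix z assume z: "z \<in> Stolz_angle \<zeta> M'"
    then have b: "z \<in> ball 0 1" by (simp add: Stolz_angle_def)
    have "dist z \<zeta> \<le> M' * infdist z (sphere 0 1)" using z by (simp add: Stolz_angle_def)
    also have "\<dots> \<le> M * (1 - cmod z)"
      using infdist_unit_circle[OF b] infdist_nonneg[of z "sphere 0 1"] by (intro mult_mono) (auto simp: M_def)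
    finally show "z \<in> closed_Stolz \<zeta> M" using b by (simp add: closed_Stolz_def dist_norm)
  qed
  have "(\<gamma> \<longlongrightarrow> \<zeta>) (at_left 1)"
  proof -
    have "continuous_on {0..1} \<gamma>" "\<gamma> 1 = \<zeta>"
      using \<gamma> by (auto simp: nontangential_path_def path_def pathfinish_def)
    then have "(\<gamma> \<longlongrightarrow> \<zeta>) (at 1 within {0..1})"
      unfolding continuous_on_def by force
    then show ?thesis by (simp add: at_within_Icc_at_left)
  qed
  moreover have "\<forall>\<^sub>F t in at_left 1. \<gamma> t \<in> closed_Stolz \<zeta> M"
    using M' by eventually_elim (use sub in blast)
  moreover have "\<zeta> \<in> closed_Stolz \<zeta> M" using \<zeta> by (simp add: closed_Stolz_def)
  ultimately have "((\<lambda>t. h (\<gamma> t)) \<longlongrightarrow> h \<zeta>) (at_left 1)"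
    by (intro continuous_on_tendsto_compose[OF cont]) (auto simp: M_def)
  moreover have "\<forall>\<^sub>F t in at_left 1. h (\<gamma> t) = v (\<gamma> t)"
    using M' by eventually_elim (simp add: Stolz_angle_def eq)
  ultimately show "((\<lambda>t. v (\<gamma> t)) \<longlongrightarrow> h \<zeta>) (at_left 1)"
    by (rule Lim_transform_eventually)
qed

section \<open>Arc length of the exceptional sets\<close>

text \<open>The measure whose completion is arc length. Exceptional sets are all Borel, which makes this measure
the convenient one to compute in.\<close>

abbreviation borel_arc_length :: "complex measure"
  where "borel_arc_length \<equiv>
    distr (restrict_space lborel {0..<2 * pi}) (restrict_space borel (sphere 0 1)) cis"

lemma finite_measure_borel_arc_length: "finite_measure borel_arc_length"
proof (rule finite_measure.finite_measure_distr[OF _ measurable_cis_circle])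
  show "finite_measure (restrict_space lborel {0..<2 * pi})"
    by (intro finite_measureI) (simp add: emeasure_restrict_space space_restrict_space)
qed

lemma measure_borel_arc_length:
  assumes "B \<in> sets borel_arc_length"
  shows "measure borel_arc_length B = measure lborel {t \<in> {0..<2 * pi}. cis t \<in> B}"
proof -
  have "measure borel_arc_length B =
      measure (restrict_space lborel {0..<2 * pi}) (cis -` B \<inter> {0..<2 * pi})"
    using assms by (subst measure_distr[OF measurable_cis_circle]) (auto simp: space_restrict_space)
  also have "\<dots> = measure lborel (cis -` B \<inter> {0..<2 * pi})"
    by (subst measure_restrict_space) auto
  also have "cis -` B \<inter> {0..<2 * pi} = {t \<in> {0..<2 * pi}. cis t \<in> B}" by auto
  finally show ?thesis .
qed

text \<open>The principal logarithm satisfies \<open>\<bar>Ln w\<bar> \<le> 2 \<bar>w - 1\<bar>\<close> near \<open>1\<close>, and \<open>\<i> s\<close> differs from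
\<open>Ln (cis s)\<close> by a multiple of \<open>2 pi \<i>\<close>.\<close>

lemma cis_near_1:
  assumes "cmod (1 - cis s) < \<epsilon>" "\<epsilon> \<le> 1 / 2"
  obtains j :: int where "\<bar>s - 2 * pi * of_int j\<bar> \<le> 2 * \<epsilon>"
proof -
  define L where "L = Ln (cis s)"
  have "exp (\<i> * of_real s) = exp L"
    by (simp add: L_def cis_conv_exp)
  then obtain j :: int where j: "\<i> * of_real s = L + (of_int (2 * j) * pi) * \<i>"
    unfolding exp_eq by blast
  have "cmod L \<le> 2 * cmod (cis s - 1)"
    using norm_Ln_le[of "cis s - 1"] assms by (simp add: L_def norm_minus_commute)
  moreover have "L = \<i> * of_real (s - 2 * pi * of_int j)"
    using j by (simp add: algebra_simps)
  then have "cmod L = \<bar>s - 2 * pi * of_int j\<bar>"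
    by (simp only: norm_mult norm_of_real) simp
  ultimately have "\<bar>s - 2 * pi * of_int j\<bar> \<le> 2 * \<epsilon>"
    using assms(1) by (simp add: norm_minus_commute)
  then show ?thesis using that by blast
qed

lemma sets_borel_arc_length_Collect:
  assumes "f \<in> borel_measurable borel_arc_length" "B \<in> sets borel"
  shows "{\<zeta> \<in> sphere 0 1. f \<zeta> \<in> B} \<in> sets borel_arc_length"
proof -
  have "f -` B \<inter> space borel_arc_length = {\<zeta> \<in> sphere 0 1. f \<zeta> \<in> B}"
    by (auto simp: space_restrict_space)
  then show ?thesis using measurable_sets[OF assms] by (simp only:)
qed

lemma continuous_borel_measurable_arc_length:
  assumes "continuous_on UNIV f"
  shows "f \<in> borel_measurable borel_arc_length"
proof -
  have "f \<in> borel_measurable (restrict_space borel (sphere 0 1))"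
    by (rule measurable_restrict_space1[OF borel_measurable_continuous_onI[OF assms]])
  then show ?thesis by (simp only: measurable_distr_eq1)
qed

lemma near_roots_sets: "{\<zeta> \<in> sphere 0 1. cmod (1 - \<zeta> ^ N) < \<epsilon>} \<in> sets borel_arc_length"
proof -
  have "(\<lambda>\<zeta>::complex. cmod (1 - \<zeta> ^ N)) \<in> borel_measurable borel_arc_length"
    by (intro continuous_borel_measurable_arc_length continuous_intros)
  from sets_borel_arc_length_Collect[OF this, of "{..<\<epsilon>}"] show ?thesis by simp
qed

text \<open>The set is covered by \<open>N + 1\<close> parameter intervals of length \<open>4 \<epsilon> / N\<close>; the factor \<open>N\<close> cancels, and the
bound holds for all orders alike. There is one interval more than there are roots, because the root
\<open>1\<close> occurs at both ends of the parameter range.\<close>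

lemma measure_near_roots_of_unity:
  assumes N: "0 < N" and \<epsilon>: "0 < \<epsilon>" "\<epsilon> \<le> 1 / 2"
  shows "measure borel_arc_length {\<zeta> \<in> sphere 0 1. cmod (1 - \<zeta> ^ N) < \<epsilon>} \<le> 8 * \<epsilon>"
proof -
  define I where "I = (\<lambda>j::int. {(2 * pi * of_int j - 2 * \<epsilon>) / real N..(2 * pi * of_int j + 2 * \<epsilon>) / real N})"
  have cover: "{t \<in> {0..<2 * pi}. cis t \<in> {\<zeta> \<in> sphere 0 1. cmod (1 - \<zeta> ^ N) < \<epsilon>}} \<subseteq> (\<Union>j\<in>{0..int N}. I j)"
  proof
    fix t assume "t \<in> {t \<in> {0..<2 * pi}. cis t \<in> {\<zeta> \<in> sphere 0 1. cmod (1 - \<zeta> ^ N) < \<epsilon>}}"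
    then have t: "0 \<le> t" "t < 2 * pi" "cmod (1 - cis (real N * t)) < \<epsilon>"
      by (auto simp: Complex.DeMoivre)
    obtain j :: int where j: "\<bar>real N * t - 2 * pi * of_int j\<bar> \<le> 2 * \<epsilon>"
      using cis_near_1[OF t(3) \<epsilon>(2)] by blast
    have "0 \<le> real N * t" "real N * t < real N * (2 * pi)" using t N by auto
    then have "2 * pi * (- 1) < 2 * pi * of_int j" "2 * pi * of_int j < 2 * pi * (real N + 1)"
      using j \<epsilon> pi_gt3 by (simp_all add: algebra_simps)
    moreover have "0 < 2 * pi" by simp
    ultimately have "- 1 < real_of_int j" "real_of_int j < real N + 1"
      using mult_less_cancel_left_pos by blast+
    then have "- 1 < j" "j < int N + 1" by linarith+
    then have "j \<in> {0..int N}" by simp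
    moreover have "t \<in> I j"
      using j N unfolding I_def by (auto simp: field_simps abs_le_iff)
    ultimately show "t \<in> (\<Union>j\<in>{0..int N}. I j)" by blast
  qed
  have I: "I j \<in> fmeasurable lborel" "measure lborel (I j) = 4 * \<epsilon> / real N" for j
  proof -
    have "(2 * pi * of_int j - 2 * \<epsilon>) / real N \<le> (2 * pi * of_int j + 2 * \<epsilon>) / real N"
      using \<epsilon> by (intro divide_right_mono) auto
    then show "measure lborel (I j) = 4 * \<epsilon> / real N"
      unfolding I_def by (simp add: diff_divide_distrib[symmetric])
    show "I j \<in> fmeasurable lborel"
      unfolding I_def by (simp add: fmeasurable_def emeasure_lborel_Icc_eq)
  qed
  have "measure borel_arc_length {\<zeta> \<in> sphere 0 1. cmod (1 - \<zeta> ^ N) < \<epsilon>} =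
      measure lborel {t \<in> {0..<2 * pi}. cis t \<in> {\<zeta> \<in> sphere 0 1. cmod (1 - \<zeta> ^ N) < \<epsilon>}}"
    by (rule measure_borel_arc_length[OF near_roots_sets])
  also have "\<dots> \<le> measure lborel (\<Union>j\<in>{0..int N}. I j)"
  proof (rule measure_mono_fmeasurable[OF cover])
    show "(\<Union>j\<in>{0..int N}. I j) \<in> fmeasurable lborel"
      by (intro fmeasurable.finite_UN) (auto simp: I)
    have "{t \<in> {0..<2 * pi}. cis t \<in> {\<zeta> \<in> sphere 0 1. cmod (1 - \<zeta> ^ N) < \<epsilon>}} =
      {0..<2 * pi} \<inter> {t. cmod (1 - cis t ^ N) < \<epsilon>}" by auto
    moreover have "open {t. cmod (1 - cis t ^ N) < \<epsilon>}"
      by (intro open_Collect_less continuous_intros)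
    ultimately show "{t \<in> {0..<2 * pi}. cis t \<in> {\<zeta> \<in> sphere 0 1. cmod (1 - \<zeta> ^ N) < \<epsilon>}} \<in> sets lborel"
      by simp
  qed
  also have "\<dots> \<le> (\<Sum>j\<in>{0..int N}. measure lborel (I j))"
    using I by (intro measure_UNION_le) (auto simp: fmeasurable_def)
  also have "\<dots> = (real N + 1) * (4 * \<epsilon> / real N)" by (simp add: I)
  also have "\<dots> \<le> 8 * \<epsilon>" using N \<epsilon> by (simp add: field_simps)
  finally show ?thesis .
qed

lemma AE_not_root_of_unity:
  assumes "0 < N"
  shows "AE \<zeta> in borel_arc_length. \<zeta> ^ N \<noteq> 1"
proof -
  interpret finite_measure borel_arc_length by (rule finite_measure_borel_arc_length)
  let ?E = "\<lambda>\<epsilon>. {\<zeta> \<in> sphere 0 1. cmod (1 - \<zeta> ^ N) < \<epsilon>}"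
  have Z: "{\<zeta> \<in> sphere 0 1. \<zeta> ^ N = 1} \<in> sets borel_arc_length"
  proof -
    have "(\<lambda>\<zeta>::complex. \<zeta> ^ N) \<in> borel_measurable borel_arc_length"
      by (intro continuous_borel_measurable_arc_length continuous_intros)
    from sets_borel_arc_length_Collect[OF this, of "{1}"] show ?thesis by simp
  qed
  have "measure borel_arc_length {\<zeta> \<in> sphere 0 1. \<zeta> ^ N = 1} \<le> 0 + e" if e: "0 < e" for e
  proof -
    define \<epsilon> where "\<epsilon> = min (1 / 2) (e / 8)"
    have "measure borel_arc_length {\<zeta> \<in> sphere 0 1. \<zeta> ^ N = 1} \<le> measure borel_arc_length (?E \<epsilon>)"
      using e by (intro finite_measure_mono near_roots_sets) (auto simp: \<epsilon>_def)
    also have "\<dots> \<le> 8 * \<epsilon>"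
      using e assms by (intro measure_near_roots_of_unity) (auto simp: \<epsilon>_def)
    finally show ?thesis by (simp add: \<epsilon>_def)
  qed
  then have "measure borel_arc_length {\<zeta> \<in> sphere 0 1. \<zeta> ^ N = 1} \<le> 0"
    by (rule field_le_epsilon)
  then have "measure borel_arc_length {\<zeta> \<in> sphere 0 1. \<zeta> ^ N = 1} = 0"
    by (simp only: measure_le_0_iff)
  then have "{\<zeta> \<in> sphere 0 1. \<zeta> ^ N = 1} \<in> null_sets borel_arc_length"
    using Z by (simp add: null_sets_def emeasure_eq_measure)
  then show ?thesis by (rule AE_I') (auto simp: space_restrict_space)
qed

section \<open>Fast approximation by polynomials\<close>

text \<open>A measurable function on the line is almost everywhere a limit of continuous functions \<open>h n\<close>. These
need not be periodic, so \<open>h n\<close> is transported only to the arc \<open>cis ` J n\<close>, which omits a shrinking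
neighbourhood of \<open>1\<close>; from there the Tietze theorem extends it continuously, and the
Stone-Weierstrass theorem replaces the extension by a polynomial.\<close>

lemma measurable_limit_of_polynomials_on_circle:
  assumes f: "f \<in> borel_measurable borel_arc_length"
  obtains p where "\<And>n. real_polynomial_function (p n :: complex \<Rightarrow> real)"
    "AE t in restrict_space lborel {0..<2 * pi}. (\<lambda>n. p n (cis t)) \<longlonglongrightarrow> f (cis t)"
proof -
  define \<psi> where "\<psi> = (\<lambda>t. if t \<in> {0..<2 * pi} then f (cis t) else 0)"
  have "(\<lambda>t. f (cis t)) \<in> borel_measurable (restrict_space lborel {0..<2 * pi})"
    by (rule measurable_compose[OF measurable_cis_circle]) (use f in simp)
  then have "\<psi> \<in> borel_measurable lborel"
    unfolding \<psi>_def by (intro measurable_restrict_space_iff[THEN iffD1]) auto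
  then have "\<psi> \<in> borel_measurable lebesgue"
    by (rule measurable_completion)
  then have "\<psi> measurable_on UNIV"
    by (rule lebesgue_measurable_imp_measurable_on) simp
  then obtain Z h where Z: "negligible Z" and h: "\<And>n. continuous_on UNIV (h n)"
    and lim: "\<And>t. t \<notin> Z \<Longrightarrow> (\<lambda>n. h n t) \<longlonglongrightarrow> \<psi> t"
    unfolding measurable_on_def by auto
  define J where "J = (\<lambda>n::nat. {1 / real (Suc n)..2 * pi - 1 / real (Suc n)})"
  have arg: "Arg2pi (cis t) = t" if "0 \<le> t" "t < 2 * pi" for t
    using that Arg2pi_exp[of "\<i> * of_real t"] by (simp add: cis_conv_exp)
  have J: "0 < t" "t < 2 * pi" if "t \<in> J n" for n t
    using that by (auto simp: J_def intro: less_le_trans[of 0 "1 / (1 + real n)"])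
        (smt (verit, best) divide_pos_pos of_nat_0_le_iff)
  have "\<exists>q. real_polynomial_function q \<and>
      (\<forall>t\<in>J n. \<bar>q (cis t) - h n t\<bar> < 1 / real (Suc n))" for n
  proof -
    have "continuous_on (cis ` J n) Arg2pi"
    proof (intro continuous_at_imp_continuous_on ballI continuous_at_Arg2pi)
      fix z assume "z \<in> cis ` J n"
      then obtain t where t: "z = cis t" "t \<in> J n" by auto
      then have "Arg2pi z \<noteq> 0" using arg[of t] J[of t n] by simp
      then show "z \<notin> \<real>\<^sub>\<ge>\<^sub>0"
        by (auto simp: Arg2pi_eq_0 complex_nonneg_Reals_iff complex_is_Real_iff)
    qed
    then have "continuous_on (cis ` J n) (\<lambda>z. h n (Arg2pi z))"
      by (rule continuous_on_compose2[OF h]) simp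
    moreover have "closedin (top_of_set UNIV) (cis ` J n)"
      unfolding J_def
      by (auto intro!: compact_imp_closed compact_continuous_image continuous_intros)
    ultimately obtain G where G: "continuous_on UNIV G"
      "\<And>z. z \<in> cis ` J n \<Longrightarrow> G z = h n (Arg2pi z)"
      by (rule Tietze_unbounded) blast
    have "compact (sphere (0::complex) 1)" by simp
    moreover have "continuous_on (sphere 0 1) G" using G(1) by (rule continuous_on_subset) simp
    moreover have "0 < 1 / real (Suc n)" by simp
    ultimately obtain q where q: "real_polynomial_function q"
      "\<And>z. z \<in> sphere 0 1 \<Longrightarrow> \<bar>G z - q z\<bar> < 1 / real (Suc n)"
      by (rule Stone_Weierstrass_real_polynomial_function) blast
    have "\<bar>q (cis t) - h n t\<bar> < 1 / real (Suc n)" if t: "t \<in> J n" for t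
      using q(2)[of "cis t"] G(2)[of "cis t"] t arg[of t] J[OF t] by (simp add: abs_minus_commute)
    then show ?thesis using q(1) by blast
  qed
  then obtain p where p: "\<And>n. real_polynomial_function (p n)"
    "\<And>n t. t \<in> J n \<Longrightarrow> \<bar>p n (cis t) - h n t\<bar> < 1 / real (Suc n)"
    by metis
  have conv: "(\<lambda>n. p n (cis t)) \<longlonglongrightarrow> f (cis t)" if t: "0 < t" "t < 2 * pi" "t \<notin> Z" for t
  proof -
    have zero: "(\<lambda>n. 1 / real (Suc n)) \<longlonglongrightarrow> 0" by real_asymp
    from order_tendstoD(2)[OF zero, of "min t (2 * pi - t)"]
    have close: "\<forall>\<^sub>F n in sequentially. norm (p n (cis t) - h n t) \<le> 1 / real (Suc n)"
      using t by (auto simp: J_def simp del: of_nat_Suc intro!: less_imp_le p(2) elim!: eventually_mono)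
    have "(\<lambda>n. p n (cis t) - h n t) \<longlonglongrightarrow> 0"
      by (rule Lim_null_comparison[OF close zero])
    from tendsto_add[OF this lim[OF t(3)]] show ?thesis
      using t by (simp add: \<psi>_def)
  qed
  have "AE t in lebesgue. t \<notin> Z"
    using Z by (intro AE_not_in) (simp add: negligible_iff_null_sets)
  then have "AE t in lborel. t \<notin> Z"
    by (simp only: AE_completion_iff)
  moreover have "AE t in lborel. t \<noteq> (0::real)" by (rule AE_lborel_singleton)
  ultimately have "AE t in lborel. t \<in> {0..<2 * pi} \<longrightarrow> (\<lambda>n. p n (cis t)) \<longlonglongrightarrow> f (cis t)"
    by eventually_elim (use conv in auto)
  then have "AE t in restrict_space lborel {0..<2 * pi}. (\<lambda>n. p n (cis t)) \<longlonglongrightarrow> f (cis t)"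
    by (subst AE_restrict_space_iff) auto
  then show ?thesis using that p(1) by blast
qed

lemma real_polynomial_function_continuous:
  "real_polynomial_function p \<Longrightarrow> continuous_on S p"
  using continuous_on_polymonial_function real_polynomial_function_eq by blast

text \<open>Convergence almost everywhere implies convergence in measure, because arc length is finite: dominated
convergence for the indicators of the sets where the error exceeds \<open>\<delta>\<close>.\<close>

lemma approximate_in_measure_on_circle:
  assumes f: "f \<in> borel_measurable borel_arc_length" and \<delta>: "0 < \<delta>" and e: "0 < e"
  obtains p where "real_polynomial_function (p :: complex \<Rightarrow> real)"
    "measure borel_arc_length {\<zeta> \<in> sphere 0 1. \<delta> < \<bar>p \<zeta> - f \<zeta>\<bar>} < e"
proof -
  let ?L = "restrict_space lborel {0..<2 * pi}"
  interpret L: finite_measure ?L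
    by (intro finite_measureI) (simp add: emeasure_restrict_space space_restrict_space)
  obtain p where p: "\<And>n. real_polynomial_function (p n :: complex \<Rightarrow> real)"
    and lim: "AE t in ?L. (\<lambda>n. p n (cis t)) \<longlonglongrightarrow> f (cis t)"
    using measurable_limit_of_polynomials_on_circle[OF f] by blast
  define B where "B = (\<lambda>n. {\<zeta> \<in> sphere 0 1. \<delta> < \<bar>p n \<zeta> - f \<zeta>\<bar>})"
  have B: "B n \<in> sets borel_arc_length" for n
  proof -
    have "p n \<in> borel_measurable borel_arc_length"
      by (intro continuous_borel_measurable_arc_length real_polynomial_function_continuous p)
    then have "(\<lambda>\<zeta>. \<bar>p n \<zeta> - f \<zeta>\<bar>) \<in> borel_measurable borel_arc_length"
      using f by (intro borel_measurable_abs borel_measurable_diff)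
    from sets_borel_arc_length_Collect[OF this, of "{\<delta><..}"] show ?thesis by (simp add: B_def)
  qed
  define E where "E = (\<lambda>n. cis -` B n \<inter> space ?L)"
  have E: "E n \<in> sets ?L" for n
    using measurable_sets[OF measurable_cis_circle] B[of n] by (simp add: E_def)
  have "(\<lambda>n. \<integral>t. (indicator (E n) t :: real) \<partial>?L) \<longlonglongrightarrow> (\<integral>t. 0 \<partial>?L)"
  proof (rule integral_dominated_convergence[where w = "\<lambda>_. 1"])
    show "AE t in ?L. (\<lambda>n. indicator (E n) t :: real) \<longlonglongrightarrow> 0"
      using lim
    proof eventually_elim
      case (elim t)
      have "\<forall>\<^sub>F n in sequentially. dist (p n (cis t)) (f (cis t)) < \<delta>"
        using elim \<delta> by (rule tendstoD)
      then have "\<forall>\<^sub>F n in sequentially. (indicator (E n) t :: real) = 0"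
        by eventually_elim (auto simp: E_def B_def dist_real_def)
      then show ?case by (rule tendsto_eventually)
    qed
  qed (use E in auto)
  moreover have "E n \<inter> {0..<2 * pi} = E n" for n
    by (auto simp: E_def space_restrict_space)
  ultimately have "(\<lambda>n. measure ?L (E n)) \<longlonglongrightarrow> 0"
    using E by (simp add: space_restrict_space)
  moreover have "measure ?L (E n) = measure borel_arc_length (B n)" for n
    unfolding E_def using B[of n] by (subst measure_distr[OF measurable_cis_circle]) auto
  ultimately have "\<forall>\<^sub>F n in sequentially. measure borel_arc_length (B n) < e"
    using order_tendstoD(2)[of _ 0 sequentially e] e by simp
  then obtain n where "measure borel_arc_length (B n) < e"
    using eventually_happens by fastforce
  then show ?thesis using that[OF p] by (auto simp: B_def)
qed

text \<open>Approximation in measure with errors \<open>4 ^ (-k)\<close> outside sets of measure \<open>2 ^ (-k)\<close>, followed by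
Borel-Cantelli.\<close>

lemma fast_polynomial_approximation_on_circle:
  assumes f: "f \<in> borel_measurable borel_arc_length"
  obtains T where "\<And>k. real_polynomial_function (T k :: complex \<Rightarrow> real)"
    "AE \<zeta> in borel_arc_length. \<forall>\<^sub>F k in sequentially. \<bar>T k \<zeta> - f \<zeta>\<bar> \<le> (1 / 4) ^ k"
proof -
  interpret finite_measure borel_arc_length by (rule finite_measure_borel_arc_length)
  define B where "B = (\<lambda>(k::nat) p. {\<zeta> \<in> sphere 0 1. (1 / 4) ^ k < \<bar>p \<zeta> - f \<zeta>\<bar>})"
  have "\<exists>p. real_polynomial_function p \<and> measure borel_arc_length (B k p) < (1 / 2) ^ k" for k
  proof -
    have "0 < (1 / 4 :: real) ^ k" "0 < (1 / 2 :: real) ^ k" by simp_all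
    from approximate_in_measure_on_circle[OF f this] show ?thesis
      unfolding B_def by blast
  qed
  then obtain T where T: "\<And>k. real_polynomial_function (T k)"
    and small: "\<And>k. measure borel_arc_length (B k (T k)) < (1 / 2) ^ k"
    by metis
  have "AE \<zeta> in borel_arc_length. \<forall>\<^sub>F k in sequentially. \<zeta> \<in> space borel_arc_length - B k (T k)"
  proof (rule borel_cantelli_AE1)
    show "B k (T k) \<in> sets borel_arc_length" for k
    proof -
      have "T k \<in> borel_measurable borel_arc_length"
        by (intro continuous_borel_measurable_arc_length real_polynomial_function_continuous T)
      then have "(\<lambda>\<zeta>. \<bar>T k \<zeta> - f \<zeta>\<bar>) \<in> borel_measurable borel_arc_length"
        using f by (intro borel_measurable_abs borel_measurable_diff)
      from sets_borel_arc_length_Collect[OF this, of "{(1 / 4) ^ k<..}"] show ?thesis by (simp add: B_def)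
    qed
    show "summable (\<lambda>k. measure borel_arc_length (B k (T k)))"
      by (rule summable_comparison_test'[of "\<lambda>k. (1 / 2) ^ k" 0])
        (use small in \<open>auto intro!: summable_geometric less_imp_le\<close>)
    show "emeasure borel_arc_length (B k (T k)) < \<infinity>" for k
      by (simp add: emeasure_eq_measure)
  qed
  then have "AE \<zeta> in borel_arc_length. \<forall>\<^sub>F k in sequentially. \<bar>T k \<zeta> - f \<zeta>\<bar> \<le> (1 / 4) ^ k"
    by eventually_elim (auto simp: B_def space_restrict_space elim!: eventually_mono)
  then show ?thesis using that T by blast
qed

text \<open>Borel-Cantelli again: the measures are at most \<open>8 * 2 ^ (-k-1)\<close>, however fast \<open>N\<close> grows.\<close>

lemma AE_eventually_far_from_roots_of_unity:
  assumes N: "\<And>k. 0 < N k"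
  shows "AE \<zeta> in borel_arc_length. \<forall>\<^sub>F k in sequentially. (1 / 2) ^ Suc k \<le> cmod (1 - \<zeta> ^ N k)"
proof -
  interpret finite_measure borel_arc_length by (rule finite_measure_borel_arc_length)
  let ?B = "\<lambda>k. {\<zeta> \<in> sphere 0 1. cmod (1 - \<zeta> ^ N k) < (1 / 2) ^ Suc k}"
  have small: "measure borel_arc_length (?B k) \<le> 8 * (1 / 2) ^ Suc k" for k
  proof (rule measure_near_roots_of_unity[OF N])
    have "(1 / 2 :: real) ^ k \<le> 1" by (intro power_le_one) auto
    then show "(1 / 2 :: real) ^ Suc k \<le> 1 / 2" by simp
  qed simp
  have "AE \<zeta> in borel_arc_length. \<forall>\<^sub>F k in sequentially. \<zeta> \<in> space borel_arc_length - ?B k"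
  proof (rule borel_cantelli_AE1)
    show "?B k \<in> sets borel_arc_length" for k by (rule near_roots_sets)
    have "summable (\<lambda>k. 8 * (1 / 2 :: real) ^ Suc k)"
      by (intro summable_mult summable_Suc_iff[THEN iffD2] summable_geometric) simp
    then show "summable (\<lambda>k. measure borel_arc_length (?B k))"
      by (rule summable_comparison_test'[of _ 0]) (use small in simp)
    show "emeasure borel_arc_length (?B k) < \<infinity>" for k
      by (simp add: emeasure_eq_measure)
  qed
  then show ?thesis
    by eventually_elim (auto simp: space_restrict_space not_less elim!: eventually_mono)
qed

section \<open>Solution of the boundary value problem\<close>

theorem theorem2:
  fixes \<phi> :: "complex \<Rightarrow> real"
  assumes "\<phi> \<in> borel_measurable arc_length_measure"
  shows "\<exists>u :: complex \<Rightarrow> real. harmonic_function_on (ball 0 1) u \<and>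
    (AE \<zeta> in arc_length_measure. \<exists>u\<^sub>\<zeta> :: real.
      ((\<lambda>r :: real. u (of_real r * \<zeta>)) \<longlongrightarrow> u\<^sub>\<zeta>) (at_left 1) \<and>
      ((\<lambda>t :: real. (u (\<zeta> + of_real t * interior_normal \<zeta>) - u\<^sub>\<zeta>) / t) \<longlongrightarrow> \<phi> \<zeta>) (at_right 0) \<and>
      has_nontangential_limit (dir_deriv (interior_normal \<zeta>) u) (\<phi> \<zeta>) \<zeta>)"
proof -
  obtain f where f: "f \<in> borel_measurable borel_arc_length"
    and \<phi>f: "AE \<zeta> in borel_arc_length. \<phi> \<zeta> = f \<zeta>"
    using completion_ex_borel_measurable_real[of \<phi> borel_arc_length] assms
    unfolding arc_length_measure_def by blast
  obtain T where T: "\<And>k. real_polynomial_function (T k :: complex \<Rightarrow> real)"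
    and Tf: "AE \<zeta> in borel_arc_length. \<forall>\<^sub>F k in sequentially. \<bar>T k \<zeta> - f \<zeta>\<bar> \<le> (1 / 4) ^ k"
    using fast_polynomial_approximation_on_circle[OF f] by blast
  \<comment> \<open>The zeroth term is set to zero so that the telescoping series sums to the limit of \<open>T\<close>.\<close>
  define S where "S = (\<lambda>k. if k = 0 then (\<lambda>_. 0) else T k)"
  have S: "real_polynomial_function (S k)" "S 0 z = 0" for k z
    by (auto simp: S_def T)
  obtain N g where N: "\<And>k::nat. 0 < N k" and g: "g holomorphic_on ball 0 1"
    and bdry: "\<And>\<zeta> s. cmod \<zeta> = 1 \<Longrightarrow> (\<And>k. \<zeta> ^ N k \<noteq> 1) \<Longrightarrow>
      \<forall>\<^sub>F k in sequentially. (1 / 2) ^ Suc k \<le> cmod (1 - \<zeta> ^ N k) \<Longrightarrow>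
      \<forall>\<^sub>F k in sequentially. \<bar>S (Suc k) \<zeta> - S k \<zeta>\<bar> \<le> 2 * (1 / 4) ^ k \<Longrightarrow>
      (\<lambda>k. S k \<zeta>) \<longlonglongrightarrow> s \<Longrightarrow>
      (\<forall>M\<ge>1. continuous_on (closed_Stolz \<zeta> M) g) \<and> Re (\<zeta> * g \<zeta>) = s"
    by (rule holomorphic_with_boundary_series[of S]) (use S in auto)
  obtain F where "\<And>z. z \<in> ball 0 1 \<Longrightarrow> (F has_field_derivative g z) (at z within ball 0 1)"
    using holomorphic_convex_primitive'[OF convex_ball open_ball g] by blast
  then have F: "\<And>z. z \<in> ball 0 1 \<Longrightarrow> (F has_field_derivative g z) (at z)"
    by (metis at_within_open open_ball)
  define u where "u = (\<lambda>z. - Re (F z))"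
  have harm: "harmonic_function_on (ball 0 1) u"
    unfolding u_def by (rule harmonic_minus_Re_primitive(1)[OF F g])
  have dir: "dir_deriv v u z = - Re (g z * v)" if "z \<in> ball 0 1" for v z
    unfolding u_def by (rule harmonic_minus_Re_primitive(2)[OF F g that])
  have good: "\<exists>u1. ((\<lambda>r. u (of_real r * \<zeta>)) \<longlongrightarrow> u1) (at_left 1) \<and>
      ((\<lambda>t. (u (\<zeta> + of_real t * interior_normal \<zeta>) - u1) / t) \<longlongrightarrow> f \<zeta>) (at_right 0) \<and>
      has_nontangential_limit (dir_deriv (interior_normal \<zeta>) u) (f \<zeta>) \<zeta>"
    if \<zeta>: "cmod \<zeta> = 1" and ne: "\<And>k. \<zeta> ^ N k \<noteq> 1"
      and far: "\<forall>\<^sub>F k in sequentially. (1 / 2) ^ Suc k \<le> cmod (1 - \<zeta> ^ N k)"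
      and near: "\<forall>\<^sub>F k in sequentially. \<bar>T k \<zeta> - f \<zeta>\<bar> \<le> (1 / 4) ^ k" for \<zeta>
  proof -
    have S_near: "\<forall>\<^sub>F k in sequentially. \<bar>S k \<zeta> - f \<zeta>\<bar> \<le> (1 / 4) ^ k"
      using near eventually_gt_at_top[of 0] by eventually_elim (simp add: S_def)
    have "\<forall>\<^sub>F k in sequentially. \<bar>S (Suc k) \<zeta> - f \<zeta>\<bar> \<le> (1 / 4) ^ Suc k"
      using eventually_sequentially_Suc[of "\<lambda>k. \<bar>S k \<zeta> - f \<zeta>\<bar> \<le> (1 / 4) ^ k"] S_near
      by (rule iffD2)
    with S_near have "\<forall>\<^sub>F k in sequentially. \<bar>S (Suc k) \<zeta> - S k \<zeta>\<bar> \<le> 2 * (1 / 4) ^ k"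
    proof eventually_elim
      case (elim k)
      have "(1 / 4 :: real) ^ Suc k \<le> (1 / 4) ^ k" by simp
      then show ?case using elim by linarith
    qed
    moreover have "(\<lambda>k. S k \<zeta>) \<longlonglongrightarrow> f \<zeta>"
    proof (rule Lim_null[THEN iffD2], rule Lim_null_comparison)
      show "\<forall>\<^sub>F k in sequentially. norm (S k \<zeta> - f \<zeta>) \<le> (1 / 4) ^ k" using S_near by simp
      show "(\<lambda>k. (1 / 4 :: real) ^ k) \<longlonglongrightarrow> 0" by (rule LIMSEQ_realpow_zero) auto
    qed
    ultimately have cont: "\<And>M. 1 \<le> M \<Longrightarrow> continuous_on (closed_Stolz \<zeta> M) g"
      and val: "Re (\<zeta> * g \<zeta>) = f \<zeta>"
      using bdry[OF \<zeta> ne far] by blast+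
    obtain u1 where "((\<lambda>r. u (of_real r * \<zeta>)) \<longlongrightarrow> u1) (at_left 1)"
      "((\<lambda>t. (u (\<zeta> + of_real t * interior_normal \<zeta>) - u1) / t) \<longlongrightarrow> f \<zeta>) (at_right 0)"
      using radial_limit_and_normal_derivative[OF F \<zeta> cont, of u] val by (auto simp: u_def)
    moreover have "has_nontangential_limit (dir_deriv (interior_normal \<zeta>) u) (Re (\<zeta> * g \<zeta>)) \<zeta>"
    proof (rule nontangential_limit_from_closed_Stolz[OF \<zeta>, where h = "\<lambda>z. Re (\<zeta> * g z)"])
      show "continuous_on (closed_Stolz \<zeta> M) (\<lambda>z. Re (\<zeta> * g z))" if "1 \<le> M" for M
        by (intro continuous_intros cont that)
      show "dir_deriv (interior_normal \<zeta>) u z = Re (\<zeta> * g z)" if "z \<in> ball 0 1" for z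
        using dir[OF that, of "interior_normal \<zeta>"] by (simp add: interior_normal_def mult_ac)
    qed
    ultimately show ?thesis using val by auto
  qed
  have "AE \<zeta> in borel_arc_length. \<forall>k. \<zeta> ^ N k \<noteq> 1"
    unfolding AE_all_countable using AE_not_root_of_unity N by blast
  moreover have "AE \<zeta> in borel_arc_length. cmod \<zeta> = 1"
    by (rule AE_I2) (simp add: space_restrict_space)
  moreover note AE_eventually_far_from_roots_of_unity[of N, OF N] Tf \<phi>f
  ultimately have "AE \<zeta> in borel_arc_length. \<exists>u1. ((\<lambda>r. u (of_real r * \<zeta>)) \<longlongrightarrow> u1) (at_left 1) \<and>
      ((\<lambda>t. (u (\<zeta> + of_real t * interior_normal \<zeta>) - u1) / t) \<longlongrightarrow> \<phi> \<zeta>) (at_right 0) \<and>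
      has_nontangential_limit (dir_deriv (interior_normal \<zeta>) u) (\<phi> \<zeta>) \<zeta>"
  proof eventually_elim
    case (elim \<zeta>)
    show ?case
      unfolding elim(5) by (rule good[OF elim(2) elim(1)[rule_format] elim(3,4)])
  qed
  then have "AE \<zeta> in arc_length_measure. \<exists>u1. ((\<lambda>r. u (of_real r * \<zeta>)) \<longlongrightarrow> u1) (at_left 1) \<and>
      ((\<lambda>t. (u (\<zeta> + of_real t * interior_normal \<zeta>) - u1) / t) \<longlongrightarrow> \<phi> \<zeta>) (at_right 0) \<and>
      has_nontangential_limit (dir_deriv (interior_normal \<zeta>) u) (\<phi> \<zeta>) \<zeta>"
    unfolding arc_length_measure_def by (rule AE_completion)
  with harm show ?thesis by blast
qed

end
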